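(* Let $\widetilde C_0,\widetilde C_1>0$ and $C_0,C_1>0$ satisfy $$\widetilde C_0=C_0\exp\left(\langle\phi_0\rangle C_1\right),\qquad \widetilde C_1=C_1\exp\left(\langle\phi_1\rangle C_0\right).$$ The solution $\varrho_i\equiv C_i$, $i=0,1$, of the system of equations $$(a_0*\varrho_0)e^{-(\phi_0*\varrho_1)}=\varrho_0\left(a_0*e^{-(\phi_0*\varrho_1)}\right),\qquad (a_1*\varrho_1)e^{-(\phi_1*\varrho_0)}=\varrho_1\left(a_1*e^{-(\phi_1*\varrho_0)}\right)$$ is locally stable in $\mathcal{S}(\widetilde C_0,\widetilde C_1)$ whenever $$C_0C_1\langle\phi_0\rangle\langle\phi_1\rangle<1.$$ This means that there exists $\delta>0$ such that $\varrho_i\equiv C_i$, $i=0,1$, is the only solution in the set $K_\delta:=\mathcal{S}(\widetilde C_0,\widetilde C_1)\cap\{\varrho:\|\varrho-C\|_\infty<\delta\}$, where $C=(C_0,C_1)$.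
   Context: For $i=0,1$: $a_i:\mathbb{R}^d\to[0,+\infty)$ with $a_i(x)=a_i(-x)$ and $\int a_i(x)dx=:\alpha_i<\infty$; $\phi_i:\mathbb{R}^d\to[0,+\infty)$ with $\phi_i(x)=\phi_i(-x)$, $\int\phi_i(x)dx=:\langle\phi_i\rangle<\infty$ and $\mathrm{ess\,sup}_x\phi_i(x)<\infty$. $*$ is convolution on $\mathbb{R}^d$; $\|\varrho\|_\infty=\max_{i=0,1}\|\varrho_i\|_{L^\infty}$ for $\varrho=(\varrho_0,\varrho_1)\in L^\infty(\mathbb{R}^d\to\mathbb{R}^2)$; positive means $\varrho_i\ge0$ a.e., $i=0,1$. For $\widetilde C_0,\widetilde C_1>0$, $\mathcal{S}(\widetilde C_0,\widetilde C_1)$ is the set of all positive $(\varrho_0,\varrho_1)\in L^\infty(\mathbb{R}^d\to\mathbb{R}^2)$ satisfying $$\varrho_0=\widetilde C_0\exp\left(-(\phi_0*\varrho_1)\right),\qquad\varrho_1=\widetilde C_1\exp\left(-(\phi_1*\varrho_0)\right);$$ each element of it solves the system in the claim (the equations for stationary solutions of the kinetic equations). *)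

theory Defs
  imports "HOL-Probability.Essential_Supremum"
begin

definition convol :: "('a::euclidean_space \<Rightarrow> real) \<Rightarrow> ('a \<Rightarrow> real) \<Rightarrow> 'a \<Rightarrow> real"  (infixl "\<star>" 75)
  where "(f \<star> g) x = (\<integral>y. f (x - y) * g y \<partial>lebesgue)"

definition linf_norm :: "('a::euclidean_space \<Rightarrow> real) \<Rightarrow> ereal"
  where "linf_norm f = esssup lebesgue (\<lambda>x. ereal \<bar>f x\<bar>)"

text \<open>
  An element of $L^\infty(\mathbf{R}^d \to \mathbf{R}^2)$ is represented by the pair of its
  components, each of them a representative of its class modulo almost-everywhere equality.
  Accordingly, all equations between such elements are required almost everywhere.
\<close>

type_synonym 'a density = "('a \<Rightarrow> real) \<times> ('a \<Rightarrow> real)"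

definition linf_norm2 :: "'a::euclidean_space density \<Rightarrow> ereal"
  where "linf_norm2 \<rho> = max (linf_norm (fst \<rho>)) (linf_norm (snd \<rho>))"

definition linf_space2 :: "'a::euclidean_space density set"
  where "linf_space2 =
    {\<rho>. fst \<rho> \<in> borel_measurable lebesgue \<and> snd \<rho> \<in> borel_measurable lebesgue \<and>
        linf_norm2 \<rho> < \<infinity>}"

definition ae_equal :: "'a::euclidean_space density \<Rightarrow> 'a density \<Rightarrow> bool"
  where "ae_equal \<rho> \<sigma> \<longleftrightarrow>
    (AE x in lebesgue. fst \<rho> x = fst \<sigma> x) \<and> (AE x in lebesgue. snd \<rho> x = snd \<sigma> x)"

definition positive_density :: "'a::euclidean_space density \<Rightarrow> bool"
  where "positive_density \<rho> \<longleftrightarrow>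
    (AE x in lebesgue. 0 \<le> fst \<rho> x) \<and> (AE x in lebesgue. 0 \<le> snd \<rho> x)"

definition stationary_solution ::
    "('a::euclidean_space \<Rightarrow> real) \<Rightarrow> ('a \<Rightarrow> real) \<Rightarrow> ('a \<Rightarrow> real) \<Rightarrow> ('a \<Rightarrow> real) \<Rightarrow> 'a density \<Rightarrow> bool"
  where "stationary_solution a0 a1 \<phi>0 \<phi>1 \<rho> \<longleftrightarrow>
    (case \<rho> of (\<rho>0, \<rho>1) \<Rightarrow>
      (AE x in lebesgue. (a0 \<star> \<rho>0) x * exp (- (\<phi>0 \<star> \<rho>1) x)
          = \<rho>0 x * (a0 \<star> (\<lambda>y. exp (- (\<phi>0 \<star> \<rho>1) y))) x) \<and>
      (AE x in lebesgue. (a1 \<star> \<rho>1) x * exp (- (\<phi>1 \<star> \<rho>0) x)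
          = \<rho>1 x * (a1 \<star> (\<lambda>y. exp (- (\<phi>1 \<star> \<rho>0) y))) x))"

definition S_set ::
    "('a::euclidean_space \<Rightarrow> real) \<Rightarrow> ('a \<Rightarrow> real) \<Rightarrow> real \<Rightarrow> real \<Rightarrow> 'a density set"
  where "S_set \<phi>0 \<phi>1 Ct0 Ct1 =
    {(\<rho>0, \<rho>1). (\<rho>0, \<rho>1) \<in> linf_space2 \<and> positive_density (\<rho>0, \<rho>1) \<and>
      (AE x in lebesgue. \<rho>0 x = Ct0 * exp (- (\<phi>0 \<star> \<rho>1) x)) \<and>
      (AE x in lebesgue. \<rho>1 x = Ct1 * exp (- (\<phi>1 \<star> \<rho>0) x))}"

definition linf_ball_in :: "'a::euclidean_space density set \<Rightarrow> 'a density \<Rightarrow> real \<Rightarrow> 'a density set"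
  where "linf_ball_in S \<sigma> \<delta> =
    {\<rho> \<in> S. linf_norm2 (\<lambda>x. fst \<rho> x - fst \<sigma> x, \<lambda>x. snd \<rho> x - snd \<sigma> x) < ereal \<delta>}"

text \<open>
  For integrable kernels and positive constants, every element of \<open>S_set\<close> is a
  stationary solution, since the exponentials in the system are then constant multiples of the
  components a.e. Hence being the only solution in a subset
  of \<open>S_set\<close> means being its only element, up to almost-everywhere equality.
\<close>

definition locally_stable_in :: "'a::euclidean_space density set \<Rightarrow> 'a density \<Rightarrow> bool"
  where "locally_stable_in S \<sigma> \<longleftrightarrow>
    (\<exists>\<delta>>0. \<sigma> \<in> linf_ball_in S \<sigma> \<delta> \<and> (\<forall>\<rho> \<in> linf_ball_in S \<sigma> \<delta>. ae_equal \<rho> \<sigma>))"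

end

theory Submission
  imports Defs
begin

text \<open>
  A constant density makes every convolution in the system constant, because Lebesgue measure is
  invariant under \<open>y \<mapsto> x - y\<close>; both sides of each stationary equation then agree.

  For the stability, write an element of the solution set as a perturbation
  \<open>(C0 + u, C1 + v)\<close>. The choice of \<open>Ct0\<close> and \<open>Ct1\<close> turns the fixed point equations into
  \<open>u = C0 * (exp (- (\<phi>0 \<star> v)) - 1)\<close> and \<open>v = C1 * (exp (- (\<phi>1 \<star> u)) - 1)\<close>.
  Convolution with a nonnegative kernel multiplies a uniform bound by at most the integral of the
  kernel, and \<open>exp (- t) - 1\<close> is, up to a factor \<open>exp \<bar>t\<bar>\<close>, bounded by \<open>\<bar>t\<bar>\<close>. So, as long as both
  perturbations are at most \<open>\<delta>\<close>, going once around the system shrinks a bound on \<open>v\<close> by the factor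
  \<open>C0 * C1 * p * q * exp ((p + q) * \<delta>)\<close>, where \<open>p\<close> and \<open>q\<close> are the integrals of the
  kernels (\<open>linearised_bound\<close> used twice). By hypothesis this factor is below 1 for small
  \<open>\<delta>\<close>, and iterating the bound forces \<open>v = 0\<close>, hence also \<open>u = 0\<close>.
\<close>

text \<open>
  The map \<open>y \<mapsto> x - y\<close> is the affine map with all scaling factors \<open>-1\<close>, whose Jacobian has
  modulus 1.
\<close>

lemma lebesgue_distr_reflect:
  fixes x :: "'a::euclidean_space"
  shows "distr lebesgue lebesgue (\<lambda>y. x - y) = lebesgue"
    and measurable_reflect: "(\<lambda>y. x - y) \<in> lebesgue \<rightarrow>\<^sub>M lebesgue"
proof -
  have T: "x + (\<Sum>j\<in>Basis. ((- 1) * (y \<bullet> j)) *\<^sub>R j) = x - y" for y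
    using euclidean_representation[of y] by (simp add: sum_negf)
  show "(\<lambda>y. x - y) \<in> lebesgue \<rightarrow>\<^sub>M lebesgue"
    using lebesgue_affine_measurable[of "\<lambda>_. - 1" x] unfolding T by simp
  show "distr lebesgue lebesgue (\<lambda>y. x - y) = lebesgue"
    using lebesgue_affine_euclidean[of "\<lambda>_. - 1" x] unfolding T by (simp add: density_1)
qed

lemma integrable_reflect:
  fixes f :: "'a::euclidean_space \<Rightarrow> real"
  assumes "integrable lebesgue f"
  shows "integrable lebesgue (\<lambda>y. f (x - y))"
  using integrable_distr[OF measurable_reflect, of x f] assms
  by (simp add: lebesgue_distr_reflect)

lemma integral_reflect:
  fixes f :: "'a::euclidean_space \<Rightarrow> real"
  assumes "integrable lebesgue f"
  shows "(\<integral>y. f (x - y) \<partial>lebesgue) = (\<integral>y. f y \<partial>lebesgue)"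
  using integral_distr[OF measurable_reflect, of f x] assms
  by (simp add: lebesgue_distr_reflect)

lemma convol_const:
  assumes "integrable lebesgue f"
  shows "(f \<star> (\<lambda>y. c)) x = (\<integral>y. f y \<partial>lebesgue) * c"
  using integral_reflect[OF assms, of x] by (simp add: convol_def)

lemma integrable_convol_integrand:
  fixes f g :: "'a::euclidean_space \<Rightarrow> real"
  assumes f: "integrable lebesgue f" and g: "g \<in> borel_measurable lebesgue"
    and bound: "AE y in lebesgue. \<bar>g y\<bar> \<le> N"
  shows "integrable lebesgue (\<lambda>y. f (x - y) * g y)"
proof (rule Bochner_Integration.integrable_bound)
  show "integrable lebesgue (\<lambda>y. f (x - y) * N)"
    using integrable_reflect[OF f] by simp
  show "(\<lambda>y. f (x - y) * g y) \<in> borel_measurable lebesgue"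
    using integrable_reflect[OF f] g by (intro borel_measurable_times) auto
  show "AE y in lebesgue. norm (f (x - y) * g y) \<le> norm (f (x - y) * N)"
    using bound by eventually_elim (auto simp: abs_mult intro!: mult_left_mono)
qed

text \<open>This is Young's inequality between \<open>L\<^sup>1\<close> and \<open>L\<^sup>\<infinity>\<close>.\<close>

lemma abs_convol_le:
  fixes f g :: "'a::euclidean_space \<Rightarrow> real"
  assumes nonneg: "\<And>x. 0 \<le> f x" and f: "integrable lebesgue f"
    and g: "g \<in> borel_measurable lebesgue" and bound: "AE y in lebesgue. \<bar>g y\<bar> \<le> N"
  shows "\<bar>(f \<star> g) x\<bar> \<le> (\<integral>y. f y \<partial>lebesgue) * N"
proof -
  have "\<bar>(f \<star> g) x\<bar> \<le> (\<integral>y. \<bar>f (x - y) * g y\<bar> \<partial>lebesgue)"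
    unfolding convol_def by (rule integral_abs_bound)
  also have "\<dots> \<le> (\<integral>y. f (x - y) * N \<partial>lebesgue)"
  proof (rule integral_mono_AE)
    show "integrable lebesgue (\<lambda>y. \<bar>f (x - y) * g y\<bar>)"
      using integrable_convol_integrand[OF f g bound] by (rule integrable_abs)
    show "integrable lebesgue (\<lambda>y. f (x - y) * N)"
      using integrable_reflect[OF f] by simp
    show "AE y in lebesgue. \<bar>f (x - y) * g y\<bar> \<le> f (x - y) * N"
      using bound by eventually_elim (auto simp: abs_mult nonneg intro!: mult_left_mono)
  qed
  also have "\<dots> = (\<integral>y. f y \<partial>lebesgue) * N"
    using integral_reflect[OF f, of x] by simp
  finally show ?thesis .
qed

lemma convol_diff_const:
  assumes f: "integrable lebesgue f" and g: "g \<in> borel_measurable lebesgue"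
    and bound: "AE y in lebesgue. \<bar>g y - c\<bar> \<le> N"
  shows "(f \<star> g) x = (f \<star> (\<lambda>y. g y - c)) x + (\<integral>y. f y \<partial>lebesgue) * c"
proof -
  have "integrable lebesgue (\<lambda>y. f (x - y) * (g y - c))"
    using g by (intro integrable_convol_integrand[OF f _ bound]) simp
  moreover have "integrable lebesgue (\<lambda>y. f (x - y) * c)"
    using integrable_reflect[OF f] by simp
  ultimately have "(\<integral>y. f (x - y) * (g y - c) + f (x - y) * c \<partial>lebesgue) =
      (f \<star> (\<lambda>y. g y - c)) x + (f \<star> (\<lambda>y. c)) x"
    unfolding convol_def by (rule Bochner_Integration.integral_add)
  then show ?thesis
    unfolding convol_const[OF f] by (simp add: convol_def algebra_simps)
qed

lemma abs_exp_minus_one_le: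
  fixes t :: real
  shows "\<bar>exp (- t) - 1\<bar> \<le> \<bar>t\<bar> * exp \<bar>t\<bar>"
proof -
  have "1 - exp (- t) \<le> t"
    using exp_ge_add_one_self[of "- t"] by simp
  also have "t \<le> \<bar>t\<bar> * exp \<bar>t\<bar>"
    using mult_left_mono[of 1 "exp \<bar>t\<bar>" "\<bar>t\<bar>"] by simp
  finally have lower: "1 - exp (- t) \<le> \<bar>t\<bar> * exp \<bar>t\<bar>" .
  \<comment> \<open>The upper estimate is \<open>1 + t \<le> exp t\<close> divided by \<open>exp t\<close>.\<close>
  have "exp (- t) * (1 + t) \<le> exp (- t) * exp t"
    using exp_ge_add_one_self[of t] by (intro mult_left_mono) auto
  then have "exp (- t) - 1 \<le> (- t) * exp (- t)"
    by (simp add: exp_minus_inverse mult.commute algebra_simps flip: exp_add)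
  also have "\<dots> \<le> \<bar>t\<bar> * exp \<bar>t\<bar>"
    by (intro mult_mono) auto
  finally show ?thesis using lower by linarith
qed

text \<open>
  One equation of the fixed point system passes a bound on the perturbation of one
  component on to the other. The rough bound \<open>\<delta>\<close> only enters through the exponential factor, so
  the estimate stays linear in the bound \<open>N\<close>, which makes it possible to iterate.
\<close>

lemma linearised_bound:
  fixes \<phi> \<rho> \<sigma> :: "'a::euclidean_space \<Rightarrow> real"
  defines "p \<equiv> (\<integral>x. \<phi> x \<partial>lebesgue)"
  assumes nonneg: "\<And>x. 0 \<le> \<phi> x" and \<phi>: "integrable lebesgue \<phi>"
    and \<sigma>: "\<sigma> \<in> borel_measurable lebesgue"
    and N: "AE x in lebesgue. \<bar>\<sigma> x - D\<bar> \<le> N"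
    and \<delta>: "AE x in lebesgue. \<bar>\<sigma> x - D\<bar> \<le> \<delta>"
    and "0 \<le> C"
    and eq: "AE x in lebesgue. \<rho> x = C * exp (p * D) * exp (- (\<phi> \<star> \<sigma>) x)"
  shows "AE x in lebesgue. \<bar>\<rho> x - C\<bar> \<le> C * p * exp (p * \<delta>) * N"
  using eq
proof eventually_elim
  case (elim x)
  define t where "t = (\<phi> \<star> (\<lambda>y. \<sigma> y - D)) x"
  have "\<rho> x = C * exp (- t)"
    unfolding elim convol_diff_const[OF \<phi> \<sigma> N] t_def p_def
    by (simp add: mult.assoc flip: exp_add)
  then have "\<bar>\<rho> x - C\<bar> = C * \<bar>exp (- t) - 1\<bar>"
    using \<open>0 \<le> C\<close> by (metis abs_mult abs_of_nonneg mult.right_neutral right_diff_distrib)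
  also have "\<dots> \<le> C * (\<bar>t\<bar> * exp \<bar>t\<bar>)"
    using \<open>0 \<le> C\<close> abs_exp_minus_one_le by (rule mult_left_mono[rotated])
  also have "\<dots> \<le> C * ((p * N) * exp (p * \<delta>))"
  proof (intro mult_left_mono mult_mono)
    have meas: "(\<lambda>y. \<sigma> y - D) \<in> borel_measurable lebesgue" using \<sigma> by simp
    show tN: "\<bar>t\<bar> \<le> p * N"
      unfolding t_def p_def by (rule abs_convol_le[OF nonneg \<phi> meas N])
    show "exp \<bar>t\<bar> \<le> exp (p * \<delta>)"
      unfolding t_def p_def using abs_convol_le[OF nonneg \<phi> meas \<delta>] by simp
    show "0 \<le> p * N" using tN by linarith
  qed (use \<open>0 \<le> C\<close> in auto)
  finally show ?case by (simp add: mult_ac)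
qed

text \<open>
  The rate \<open>k\<close> may depend on the a priori bound \<open>\<delta>\<close> but not on \<open>N\<close>; then the bounds
  \<open>k ^ n * \<delta>\<close> all hold off a common null set, by countability.
\<close>

lemma AE_eq_zero_by_contraction:
  fixes v :: "'a \<Rightarrow> real"
  assumes start: "AE x in M. \<bar>v x\<bar> \<le> \<delta>"
    and step: "\<And>N. AE x in M. \<bar>v x\<bar> \<le> N \<Longrightarrow> AE x in M. \<bar>v x\<bar> \<le> k * N"
    and "0 \<le> k" "k < 1"
  shows "AE x in M. v x = 0"
proof -
  have "AE x in M. \<bar>v x\<bar> \<le> k ^ n * \<delta>" for n
  proof (induction n)
    case 0
    then show ?case using start by simp
  next
    case (Suc n)
    then show ?case using step[OF Suc] by (simp add: mult.assoc)
  qed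
  then have "AE x in M. \<forall>n. \<bar>v x\<bar> \<le> k ^ n * \<delta>"
    by (simp add: AE_all_countable)
  then show ?thesis
  proof eventually_elim
    case (elim x)
    have "(\<lambda>n. k ^ n * \<delta>) \<longlonglongrightarrow> 0"
      using LIMSEQ_realpow_zero[OF \<open>0 \<le> k\<close> \<open>k < 1\<close>] by (rule tendsto_mult_left_zero)
    then have "\<bar>v x\<bar> \<le> 0"
      using elim by (intro LIMSEQ_le_const) auto
    then show ?case by simp
  qed
qed

lemma AE_abs_le_of_linf_norm_less:
  assumes "linf_norm f < ereal \<delta>"
  shows "AE x in lebesgue. \<bar>f x\<bar> \<le> \<delta>"
proof -
  have "AE x in lebesgue. ereal \<bar>f x\<bar> \<le> linf_norm f"
    unfolding linf_norm_def by (rule esssup_AE)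
  then show ?thesis
    by eventually_elim (use assms in \<open>metis ereal_less_eq(3) less_imp_le order_trans\<close>)
qed

lemma linf_norm_const_le: "linf_norm (\<lambda>x::'a::euclidean_space. c) \<le> ereal \<bar>c\<bar>"
  unfolding linf_norm_def by (rule esssup_I) auto

lemma stationary_solution_const:
  assumes "integrable lebesgue a0" "integrable lebesgue a1"
    and "integrable lebesgue \<phi>0" "integrable lebesgue \<phi>1"
  shows "stationary_solution a0 a1 \<phi>0 \<phi>1 (\<lambda>x. C0, \<lambda>x. C1)"
  using assms by (simp add: stationary_solution_def convol_const)

lemma const_in_S_set:
  fixes \<phi>0 \<phi>1 :: "'a::euclidean_space \<Rightarrow> real"
  assumes "integrable lebesgue \<phi>0" "integrable lebesgue \<phi>1" "0 \<le> C0" "0 \<le> C1"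
  shows "(\<lambda>x. C0, \<lambda>x. C1) \<in> S_set \<phi>0 \<phi>1
    (C0 * exp ((\<integral>x. \<phi>0 x \<partial>lebesgue) * C1)) (C1 * exp ((\<integral>x. \<phi>1 x \<partial>lebesgue) * C0))"
proof -
  have "linf_norm (\<lambda>x::'a. c) < \<infinity>" for c
    using linf_norm_const_le[of c] by (rule le_less_trans) simp
  then have "linf_norm2 (\<lambda>x::'a. C0, \<lambda>x. C1) < \<infinity>"
    unfolding linf_norm2_def fst_conv snd_conv by (metis max_def)
  then show ?thesis
    using assms
    by (simp add: S_set_def linf_space2_def positive_density_def convol_const mult.assoc
        flip: exp_add)
qed

lemma linf_norm2_zero_less:
  assumes "0 < \<delta>"
  shows "linf_norm2 (\<lambda>x::'a::euclidean_space. 0, \<lambda>x. 0) < ereal \<delta>"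
proof -
  have "linf_norm (\<lambda>x::'a. 0) < ereal \<delta>"
    using linf_norm_const_le[of 0] by (rule le_less_trans) (simp add: assms)
  then show ?thesis by (simp add: linf_norm2_def)
qed

text \<open>
  Each equation carries a bound from one component to the other, with factors \<open>A\<close> and \<open>B\<close>; only
  their product has to be below 1, since a bound is compared with itself after using both.
\<close>

lemma unique_in_small_ball:
  fixes \<phi>0 \<phi>1 :: "'a::euclidean_space \<Rightarrow> real" and C0 C1 \<delta> :: real
  defines "p \<equiv> (\<integral>x. \<phi>0 x \<partial>lebesgue)" and "q \<equiv> (\<integral>x. \<phi>1 x \<partial>lebesgue)"
  defines "A \<equiv> C0 * p * exp (p * \<delta>)" and "B \<equiv> C1 * q * exp (q * \<delta>)"
  assumes \<phi>0: "\<And>x. 0 \<le> \<phi>0 x" "integrable lebesgue \<phi>0"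
    and \<phi>1: "\<And>x. 0 \<le> \<phi>1 x" "integrable lebesgue \<phi>1"
    and C: "0 \<le> C0" "0 \<le> C1"
    and contr: "B * A < 1"
    and \<rho>: "\<rho> \<in> linf_ball_in (S_set \<phi>0 \<phi>1 (C0 * exp (p * C1)) (C1 * exp (q * C0)))
      (\<lambda>x. C0, \<lambda>x. C1) \<delta>"
  shows "ae_equal \<rho> (\<lambda>x. C0, \<lambda>x. C1)"
proof -
  obtain \<rho>0 \<rho>1 where \<rho>_eq: "\<rho> = (\<rho>0, \<rho>1)" by (cases \<rho>)
  have meas: "\<rho>0 \<in> borel_measurable lebesgue" "\<rho>1 \<in> borel_measurable lebesgue"
    and eq0: "AE x in lebesgue. \<rho>0 x = C0 * exp (p * C1) * exp (- (\<phi>0 \<star> \<rho>1) x)"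
    and eq1: "AE x in lebesgue. \<rho>1 x = C1 * exp (q * C0) * exp (- (\<phi>1 \<star> \<rho>0) x)"
    and norm0: "linf_norm (\<lambda>x. \<rho>0 x - C0) < ereal \<delta>"
    and norm1: "linf_norm (\<lambda>x. \<rho>1 x - C1) < ereal \<delta>"
    using \<rho> unfolding \<rho>_eq
    by (simp_all add: linf_ball_in_def S_set_def linf_space2_def linf_norm2_def)
  note near0 = AE_abs_le_of_linf_norm_less[OF norm0]
  note near1 = AE_abs_le_of_linf_norm_less[OF norm1]
  have step0: "AE x in lebesgue. \<bar>\<rho>0 x - C0\<bar> \<le> A * N"
    if "AE x in lebesgue. \<bar>\<rho>1 x - C1\<bar> \<le> N" for N
    unfolding A_def p_def
    by (rule linearised_bound[OF \<phi>0 meas(2) that near1 C(1) eq0[unfolded p_def]])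
  have step1: "AE x in lebesgue. \<bar>\<rho>1 x - C1\<bar> \<le> B * N"
    if "AE x in lebesgue. \<bar>\<rho>0 x - C0\<bar> \<le> N" for N
    unfolding B_def q_def
    by (rule linearised_bound[OF \<phi>1 meas(1) that near0 C(2) eq1[unfolded q_def]])
  have "0 \<le> p" "0 \<le> q"
    unfolding p_def q_def using \<phi>0(1) \<phi>1(1) by simp_all
  then have "0 \<le> B * A" unfolding A_def B_def using C by simp
  have zero1: "AE x in lebesgue. \<rho>1 x - C1 = 0"
  proof (rule AE_eq_zero_by_contraction[OF near1 _ \<open>0 \<le> B * A\<close> contr])
    fix N assume "AE x in lebesgue. \<bar>\<rho>1 x - C1\<bar> \<le> N"
    from step1[OF step0[OF this]]
    show "AE x in lebesgue. \<bar>\<rho>1 x - C1\<bar> \<le> B * A * N" by (simp add: mult.assoc)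
  qed
  have "AE x in lebesgue. \<bar>\<rho>0 x - C0\<bar> \<le> A * 0"
    using zero1 by (intro step0) auto
  then show ?thesis
    using zero1 by (simp add: ae_equal_def \<rho>_eq)
qed

theorem theorem3p10:
  fixes a0 a1 \<phi>0 \<phi>1 :: "real ^ 'd \<Rightarrow> real"
    and Ct0 Ct1 C0 C1 :: real
  assumes "\<And>x. 0 \<le> a0 x" and "\<And>x. a0 x = a0 (- x)" and "integrable lebesgue a0"
    and "\<And>x. 0 \<le> a1 x" and "\<And>x. a1 x = a1 (- x)" and "integrable lebesgue a1"
    and "\<And>x. 0 \<le> \<phi>0 x" and "\<And>x. \<phi>0 x = \<phi>0 (- x)" and "integrable lebesgue \<phi>0"
    and "\<And>x. 0 \<le> \<phi>1 x" and "\<And>x. \<phi>1 x = \<phi>1 (- x)" and "integrable lebesgue \<phi>1"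
    and "esssup lebesgue (\<lambda>x. ereal (\<phi>0 x)) < \<infinity>"
    and "esssup lebesgue (\<lambda>x. ereal (\<phi>1 x)) < \<infinity>"
    and "Ct0 > 0" and "Ct1 > 0" and "C0 > 0" and "C1 > 0"
    and "Ct0 = C0 * exp ((\<integral>x. \<phi>0 x \<partial>lebesgue) * C1)"
    and "Ct1 = C1 * exp ((\<integral>x. \<phi>1 x \<partial>lebesgue) * C0)"
    and "C0 * C1 * (\<integral>x. \<phi>0 x \<partial>lebesgue) * (\<integral>x. \<phi>1 x \<partial>lebesgue) < 1"
  shows "stationary_solution a0 a1 \<phi>0 \<phi>1 (\<lambda>x. C0, \<lambda>x. C1) \<and>
    locally_stable_in (S_set \<phi>0 \<phi>1 Ct0 Ct1) (\<lambda>x. C0, \<lambda>x. C1)"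
proof
  show "stationary_solution a0 a1 \<phi>0 \<phi>1 (\<lambda>x. C0, \<lambda>x. C1)"
    using assms by (intro stationary_solution_const)
next
  define p q where "p = (\<integral>x. \<phi>0 x \<partial>lebesgue)" and "q = (\<integral>x. \<phi>1 x \<partial>lebesgue)"
  define k where "k \<delta> = (C1 * q * exp (q * \<delta>)) * (C0 * p * exp (p * \<delta>))" for \<delta>
  \<comment> \<open>At \<open>\<delta> = 0\<close> the contraction factor is the quantity that is assumed to be below 1, so
     by continuity it is still below 1 for some positive \<open>\<delta>\<close>.\<close>
  have "(k \<longlongrightarrow> k 0) (at_right 0)"
    unfolding k_def by (intro tendsto_intros)
  moreover have "k 0 < 1"
    using assms(21) by (simp add: k_def p_def q_def mult_ac)
  ultimately have "\<forall>\<^sub>F \<delta> in at_right 0. k \<delta> < 1 \<and> \<delta> > 0"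
    using eventually_at_right_less[of 0] by (intro eventually_conj order_tendstoD(2))
  then obtain \<delta> where \<delta>: "k \<delta> < 1" "0 < \<delta>"
    by (auto dest: eventually_happens simp: trivial_limit_at_right_real)
  let ?S = "S_set \<phi>0 \<phi>1 Ct0 Ct1"
  have "(\<lambda>x. C0, \<lambda>x. C1) \<in> linf_ball_in ?S (\<lambda>x. C0, \<lambda>x. C1) \<delta>"
    using const_in_S_set[of \<phi>0 \<phi>1 C0 C1] linf_norm2_zero_less[OF \<delta>(2)] assms
    by (simp add: linf_ball_in_def)
  moreover have "ae_equal \<rho> (\<lambda>x. C0, \<lambda>x. C1)"
    if "\<rho> \<in> linf_ball_in ?S (\<lambda>x. C0, \<lambda>x. C1) \<delta>" for \<rho>
    using unique_in_small_ball[of \<phi>0 \<phi>1 C0 C1 \<delta> \<rho>] \<delta>(1) that assms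
    by (simp add: k_def p_def q_def)
  ultimately show "locally_stable_in ?S (\<lambda>x. C0, \<lambda>x. C1)"
    unfolding locally_stable_in_def using \<delta>(2) by blast
qed

end
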